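(* Let $V$ and $H$ be complex Hilbert spaces, let $\mathfrak{a} \colon V \times V \to \mathbb{C}$ be a symmetric continuous sesquilinear form which is compactly elliptic, and let $j \in \mathcal{L}(V,H)$. Let $A$ be the graph associated with $(\mathfrak{a},j)$ (which is a self-adjoint graph). Then $A$ is bounded below.
   Context: Sesquilinear forms are linear in the first and antilinear in the second variable, and $\mathfrak{a}(u) := \mathfrak{a}(u,u)$. $\mathcal{L}(X,Y)$ denotes the bounded linear operators from $X$ to $Y$. The form $\mathfrak{a}$ is called compactly elliptic if there exist a Hilbert space $\widetilde{H}$, a compact $\tilde{j} \in \mathcal{L}(V,\widetilde{H})$, $\omega \in \mathbb{R}$ and $\mu > 0$ such that $\mathrm{Re}\, \mathfrak{a}(u) + \omega \|\tilde{j}(u)\|_{\widetilde{H}}^2 \geq \mu \|u\|_V^2$ for all $u \in V$. A graph in $H$ is a linear subspace of $H \times H$. The graph associated with $(\mathfrak{a},j)$ is $$A = \{(x,y) \in H \times H : \text{there exists } u \in V \text{ such that } j(u) = x \text{ and } \mathfrak{a}(u,v) = (y,j(v))_H \text{ for all } v \in V\}.$$ A graph $A$ is self-adjoint if $(x,y)_H \in \mathbb{R}$ for all $(x,y) \in A$ and, for all $s \in \mathbb{R} \setminus \{0\}$, the graph $A + isI = \{(x,y+isx) : (x,y) \in A\}$ is surjective (every $y\in H$ occurs as a second component). A self-adjoint graph $A$ is bounded below if there exists $\omega \in \mathbb{R}$ such that $(x,y)_H + \omega \|x\|_H^2 \geq 0$ for all $(x,y) \in A$. *)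

theory Defs
  imports "HOL-Analysis.Analysis"
begin

text \<open>
  A complex inner product space is a real inner product space, with real inner product
  \<open>Re (cinner x y)\<close>, that carries a compatible complex scalar multiplication; norm and topology
  are thus the library's, with \<open>norm x = sqrt (Re (cinner x x))\<close>, and positive definiteness of
  \<open>cinner\<close> is inherited from \<open>inner\<close>. The product \<open>cinner\<close> is linear in its first argument and
  antilinear in its second one.
\<close>

class complex_inner = real_inner +
  fixes scaleC :: "complex \<Rightarrow> 'a \<Rightarrow> 'a" (infixr "*\<^sub>C" 75)
    and cinner :: "'a \<Rightarrow> 'a \<Rightarrow> complex"
  assumes scaleC_add_right: "c *\<^sub>C (x + y) = c *\<^sub>C x + c *\<^sub>C y"
    and scaleC_add_left: "(c + d) *\<^sub>C x = c *\<^sub>C x + d *\<^sub>C x"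
    and scaleC_scaleC: "c *\<^sub>C d *\<^sub>C x = (c * d) *\<^sub>C x"
    and scaleR_scaleC: "r *\<^sub>R x = complex_of_real r *\<^sub>C x"
    and cinner_add_left: "cinner (x + y) z = cinner x z + cinner y z"
    and cinner_scaleC_left: "cinner (c *\<^sub>C x) y = c * cinner x y"
    and cinner_commute: "cinner x y = cnj (cinner y x)"
    and inner_eq_Re_cinner: "inner x y = Re (cinner x y)"

class complex_hilbert_space = complex_inner + complete_space

instantiation complex :: complex_hilbert_space
begin

definition scaleC_complex :: "complex \<Rightarrow> complex \<Rightarrow> complex" where
  "scaleC_complex c x = c * x"

definition cinner_complex :: "complex \<Rightarrow> complex \<Rightarrow> complex" where
  "cinner_complex x y = x * cnj y"

instance
  by standard
    (auto simp: scaleC_complex_def cinner_complex_def inner_complex_def algebra_simps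
      scaleR_conv_of_real)

end

definition bounded_clinear :: "('a::complex_inner \<Rightarrow> 'b::complex_inner) \<Rightarrow> bool" where
  "bounded_clinear T \<longleftrightarrow> bounded_linear T \<and> (\<forall>c x. T (c *\<^sub>C x) = c *\<^sub>C T x)"

definition compact_operator :: "('a::complex_inner \<Rightarrow> 'b::complex_inner) \<Rightarrow> bool" where
  "compact_operator T \<longleftrightarrow>
     bounded_clinear T \<and> (\<forall>S. bounded S \<longrightarrow> compact (closure (T ` S)))"

definition sesquilinear_form :: "('v::complex_inner \<Rightarrow> 'v \<Rightarrow> complex) \<Rightarrow> bool" where
  "sesquilinear_form a \<longleftrightarrow>
     (\<forall>u v w. a (u + v) w = a u w + a v w) \<and>
     (\<forall>c u w. a (c *\<^sub>C u) w = c * a u w) \<and>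
     (\<forall>u v w. a u (v + w) = a u v + a u w) \<and>
     (\<forall>c u w. a u (c *\<^sub>C w) = cnj c * a u w)"

definition continuous_form :: "('v::complex_inner \<Rightarrow> 'v \<Rightarrow> complex) \<Rightarrow> bool" where
  "continuous_form a \<longleftrightarrow> continuous_on UNIV (\<lambda>(u, v). a u v)"

definition symmetric_form :: "('v::complex_inner \<Rightarrow> 'v \<Rightarrow> complex) \<Rightarrow> bool" where
  "symmetric_form a \<longleftrightarrow> (\<forall>u v. a u v = cnj (a v u))"

text \<open>
  HOL formulas cannot quantify over types, so the auxiliary Hilbert space of compact ellipticity
  is a type argument. In a hypothesis a type variable in this position is universally
  quantified outside the implication, which amounts to existence of some such space in
  the hypothesis.
\<close>

definition compactly_elliptic ::
  "'k::complex_hilbert_space itself \<Rightarrow> ('v::complex_hilbert_space \<Rightarrow> 'v \<Rightarrow> complex) \<Rightarrow> bool" where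
  "compactly_elliptic K a \<longleftrightarrow>
     (\<exists>(jt :: 'v \<Rightarrow> 'k) (\<omega>::real) (\<mu>::real). compact_operator jt \<and> \<mu> > 0 \<and>
        (\<forall>u. Re (a u u) + \<omega> * (norm (jt u))\<^sup>2 \<ge> \<mu> * (norm u)\<^sup>2))"

definition linear_graph :: "('h::complex_inner \<times> 'h) set \<Rightarrow> bool" where
  "linear_graph A \<longleftrightarrow>
     (0, 0) \<in> A \<and>
     (\<forall>x y x' y'. (x, y) \<in> A \<longrightarrow> (x', y') \<in> A \<longrightarrow> (x + x', y + y') \<in> A) \<and>
     (\<forall>c x y. (x, y) \<in> A \<longrightarrow> (c *\<^sub>C x, c *\<^sub>C y) \<in> A)"

definition associated_graph ::
  "('v::complex_inner \<Rightarrow> 'v \<Rightarrow> complex) \<Rightarrow> ('v \<Rightarrow> 'h::complex_inner) \<Rightarrow> ('h \<times> 'h) set" where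
  "associated_graph a j = {(x, y). \<exists>u. j u = x \<and> (\<forall>v. a u v = cinner y (j v))}"

definition graph_shift :: "('h::complex_inner \<times> 'h) set \<Rightarrow> complex \<Rightarrow> ('h \<times> 'h) set" where
  "graph_shift A c = {(x, y + c *\<^sub>C x) | x y. (x, y) \<in> A}"

definition selfadjoint_graph :: "('h::complex_inner \<times> 'h) set \<Rightarrow> bool" where
  "selfadjoint_graph A \<longleftrightarrow>
     linear_graph A \<and>
     (\<forall>(x, y) \<in> A. cinner x y \<in> \<real>) \<and>
     (\<forall>s::real. s \<noteq> 0 \<longrightarrow> snd ` graph_shift A (\<i> * complex_of_real s) = UNIV)"

text \<open>
  An inequality \<open>z \<ge> 0\<close> between complex numbers means that \<open>z\<close> is real and nonnegative.
\<close>

definition bounded_below_graph :: "('h::complex_inner \<times> 'h) set \<Rightarrow> bool" where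
  "bounded_below_graph A \<longleftrightarrow>
     selfadjoint_graph A \<and>
     (\<exists>\<omega>::real. \<forall>(x, y) \<in> A. cinner x y \<in> \<real> \<and> Re (cinner x y) + \<omega> * (norm x)\<^sup>2 \<ge> 0)"

end

theory Submission
  imports Defs
begin

text \<open>
  Both halves of the claim, self-adjointness and the lower bound, rest on an inequality of Ehrling
  type: if \<open>T\<close> is compact and \<open>J\<close> is bounded on a closed subspace \<open>X\<close> of a Hilbert space, and
  \<open>T\<close> vanishes on \<open>X \<inter> ker J\<close>, then \<open>\<parallel>T u\<parallel>\<^sup>2 \<le> \<epsilon> \<parallel>u\<parallel>\<^sup>2 + C \<parallel>J u\<parallel>\<^sup>2\<close> on \<open>X\<close> with arbitrarily small
  \<open>\<epsilon>\<close>. It makes the compact term of the ellipticity estimate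
  \<open>\<mu> \<parallel>u\<parallel>\<^sup>2 \<le> Re a(u) + \<omega> \<parallel>T u\<parallel>\<^sup>2\<close> absorbable, at the price of a multiple of \<open>\<parallel>J u\<parallel>\<^sup>2\<close>. Its usual
  proof extracts a weak limit of a sequence that violates it; here that limit is a common
  point of a decreasing sequence of closed convex bounded sets.

  \<^bold>\<open>Lower bound.\<close> If \<open>(x, y)\<close> lies in the graph and \<open>u\<close> is a witness, then \<open>(x, y) = a(u)\<close> and
  \<open>a(u, v) = (y, j v) = 0\<close> whenever \<open>j v = 0\<close>. So it suffices to bound \<open>a(u) + C \<parallel>j u\<parallel>\<^sup>2\<close> from below
  on the closed subspace \<open>Y\<close> of all \<open>u\<close> that are \<open>a\<close>-orthogonal to \<open>ker j\<close>. The map \<open>j\<close> may have a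
  kernel \<open>N\<close> on \<open>Y\<close>, but \<open>a(Y, N) = 0\<close>, so passing to the orthogonal complement of \<open>N\<close> in \<open>Y\<close>
  changes neither \<open>a(u)\<close> nor \<open>j u\<close>. There \<open>j\<close> is injective, and the inequality with \<open>J = j\<close> yields
  \<open>a(u) + C \<parallel>j u\<parallel>\<^sup>2 \<ge> 0\<close>.

  \<^bold>\<open>Self-adjointness.\<close> Symmetry makes \<open>(x, y) = a(u)\<close> real. Surjectivity of the graph shifted by
  \<open>i s\<close> means that \<open>b(u, v) = a(u, v) + i s (j u, j v)\<close> can represent each functional \<open>v \<mapsto> (y, j v)\<close>.
  The form \<open>b\<close> is as elliptic as \<open>a\<close>. Its operator \<open>B\<close> is bounded below on \<open>(ker B)\<^sup>\<bottom>\<close>,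
  by the inequality with \<open>J = B\<close>, hence has closed range, and the equation is solvable as soon as the
  functional vanishes on every \<open>v\<close> with \<open>b(\<cdot>, v) = 0\<close>. For such \<open>v\<close> the imaginary part
  of \<open>b(v, v)\<close> gives \<open>s \<parallel>j v\<parallel>\<^sup>2 = 0\<close>, so \<open>(y, j v) = 0\<close>.

  The Hilbert space arguments are carried out in real Hilbert spaces and applied to the real parts
  of the forms; replacing \<open>v\<close> by \<open>i v\<close> recovers the imaginary parts.
\<close>

section \<open>Convex sets and projections in Hilbert spaces\<close>

text \<open>
  This replaces weak sequential compactness of bounded sets. Almost minimal elements of the sets
  form a Cauchy sequence: the midpoint of two of them stays in the larger set, so by the
  parallelogram identity their distance is controlled by the increments of the bounded
  increasing sequence of squared distances of the sets from the origin.
\<close>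

lemma nested_closed_convex_nonempty:
  fixes C :: "nat \<Rightarrow> 'a::{real_inner,complete_space} set"
  assumes closed: "\<And>n. closed (C n)" and convex: "\<And>n. convex (C n)"
    and nonempty: "\<And>n. C n \<noteq> {}" and dec: "decseq C" and bounded: "bounded (C 0)"
  shows "\<exists>x. \<forall>n. x \<in> C n"
proof -
  define d where "d n = Inf (norm ` C n)" for n
  have bdd: "bdd_below (norm ` C n)" for n
    by (rule bdd_belowI[of _ 0]) auto
  have d_le: "d n \<le> norm x" if "x \<in> C n" for n x
    unfolding d_def using that bdd by (intro cInf_lower) auto
  have d_nonneg: "0 \<le> d n" for n
    unfolding d_def using nonempty by (intro cInf_greatest) auto
  have sub: "C n \<subseteq> C m" if "m \<le> n" for m n
    using dec that by (auto dest: decseqD)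
  have d_mono: "d m \<le> d n" if "m \<le> n" for m n
    unfolding d_def using sub[OF that] nonempty bdd by (intro cInf_superset_mono) auto
  obtain M where M: "\<And>x. x \<in> C 0 \<Longrightarrow> norm x \<le> M"
    using bounded by (auto simp: bounded_iff)
  have d_bound: "d n \<le> M" for n
  proof -
    obtain x where "x \<in> C n" using nonempty by blast
    then show ?thesis using d_le[of x n] M[of x] sub[of 0 n] by force
  qed
  have "\<exists>x. x \<in> C n \<and> (norm x)\<^sup>2 \<le> (d n)\<^sup>2 + inverse (real (Suc n))" for n
  proof -
    have "d n < sqrt ((d n)\<^sup>2 + inverse (real (Suc n)))"
      by (rule real_less_rsqrt) simp
    then obtain x where "x \<in> C n" "norm x < sqrt ((d n)\<^sup>2 + inverse (real (Suc n)))"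
      using nonempty cInf_lessD[of "norm ` C n"] unfolding d_def by blast
    then show ?thesis
      by (intro exI[of _ x]) (smt (verit) norm_ge_zero real_le_rsqrt real_sqrt_le_iff real_sqrt_abs)
  qed
  then obtain x where xC: "\<And>n. x n \<in> C n"
    and x_le: "\<And>n. (norm (x n))\<^sup>2 \<le> (d n)\<^sup>2 + inverse (real (Suc n))"
    by metis
  have "incseq (\<lambda>n. (d n)\<^sup>2)"
    using d_mono d_nonneg by (auto simp: incseq_def intro: power_mono)
  moreover have "(d n)\<^sup>2 \<le> M\<^sup>2" for n
    using d_bound d_nonneg by (intro power_mono) auto
  ultimately obtain L where L: "(\<lambda>n. (d n)\<^sup>2) \<longlonglongrightarrow> L" and d_le_L: "\<And>n. (d n)\<^sup>2 \<le> L"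
    using incseq_convergent[of "\<lambda>n. (d n)\<^sup>2" "M\<^sup>2"] by auto
  \<comment> \<open>\<open>e m\<close> bounds the squared distance from \<open>x m\<close> to all later terms.\<close>
  define e where "e n = 2 * (L - (d n)\<^sup>2) + 4 * inverse (real (Suc n))" for n
  have "e \<longlonglongrightarrow> 2 * (L - L) + 4 * 0"
    unfolding e_def using L by (intro tendsto_intros LIMSEQ_inverse_real_of_nat)
  then have e0: "e \<longlonglongrightarrow> 0" by simp
  have dist_le: "(norm (x m - x n))\<^sup>2 \<le> e m" if "m \<le> n" for m n
  proof -
    define y where "y = (1/2) *\<^sub>R x m + (1/2) *\<^sub>R x n"
    have "y \<in> C m"
      unfolding y_def using xC[of m] sub[OF that] xC[of n]
      by (intro convexD[OF convex]) auto
    then have "(d m)\<^sup>2 \<le> (norm y)\<^sup>2"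
      using d_le d_nonneg by (intro power_mono) auto
    moreover have "(norm (x m - x n))\<^sup>2 = 2 * (norm (x m))\<^sup>2 + 2 * (norm (x n))\<^sup>2 - 4 * (norm y)\<^sup>2"
      unfolding y_def power2_norm_eq_inner
      by (simp add: inner_add_left inner_add_right inner_diff_left inner_diff_right inner_commute)
    moreover have "inverse (real (Suc n)) \<le> inverse (real (Suc m))"
      using that by simp
    ultimately show ?thesis
      unfolding e_def using x_le[of m] x_le[of n] d_le_L[of n] by argo
  qed
  have "Cauchy x"
  proof (rule metric_CauchyI)
    fix r :: real
    assume "0 < r"
    then have "\<forall>\<^sub>F n in sequentially. e n < (r/2)\<^sup>2"
      by (intro order_tendstoD[OF e0]) auto
    then obtain N where N: "e N < (r/2)\<^sup>2"
      by (auto simp: eventually_sequentially)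
    have near: "dist (x N) (x n) < r/2" if "N \<le> n" for n
    proof (rule power_less_imp_less_base)
      show "(dist (x N) (x n))\<^sup>2 < (r/2)\<^sup>2"
        using dist_le[OF that] N by (simp only: dist_norm)
    qed (use \<open>0 < r\<close> in simp)
    show "\<exists>N. \<forall>m\<ge>N. \<forall>n\<ge>N. dist (x m) (x n) < r"
      using near by (meson dist_triangle_half_r)
  qed
  then obtain l where l: "x \<longlonglongrightarrow> l"
    using Cauchy_convergent convergent_def by blast
  have "l \<in> C n" for n
  proof (rule Lim_in_closed_set[OF closed _ _ l])
    show "\<forall>\<^sub>F k in sequentially. x k \<in> C n"
      using eventually_ge_at_top[of n] by eventually_elim (use sub xC in blast)
  qed simp
  then show ?thesis by blast
qed

lemma closest_point_existence:
  fixes S :: "'a::{real_inner,complete_space} set"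
  assumes "closed S" "convex S" "S \<noteq> {}"
  shows "\<exists>s\<in>S. \<forall>t\<in>S. dist x s \<le> dist x t"
proof -
  define d where "d = Inf (dist x ` S)"
  have bdd: "bdd_below (dist x ` S)"
    by (rule bdd_belowI[of _ 0]) auto
  have d_le: "d \<le> dist x t" if "t \<in> S" for t
    unfolding d_def using that bdd by (intro cInf_lower) auto
  define C where "C n = S \<inter> cball x (d + inverse (real (Suc n)))" for n
  have "\<exists>s. \<forall>n. s \<in> C n"
  proof (rule nested_closed_convex_nonempty)
    fix n
    show "closed (C n)" "convex (C n)"
      unfolding C_def using assms by (auto intro: convex_Int)
    have "d < d + inverse (real (Suc n))" by simp
    then obtain t where "t \<in> S" "dist x t < d + inverse (real (Suc n))"
      using cInf_lessD[of "dist x ` S"] assms(3) unfolding d_def by blast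
    then show "C n \<noteq> {}" unfolding C_def by force
  next
    show "decseq C"
    proof (rule decseq_SucI)
      fix n
      have "inverse (real (Suc (Suc n))) \<le> inverse (real (Suc n))"
        by (intro le_imp_inverse_le) auto
      then show "C (Suc n) \<subseteq> C n"
        unfolding C_def by (intro Int_mono order_refl subset_cball add_left_mono)
    qed
    show "bounded (C 0)" unfolding C_def by (simp add: bounded_Int)
  qed
  then obtain s where s: "\<And>n. s \<in> C n" by blast
  have "(\<lambda>n. d + inverse (real (Suc n))) \<longlonglongrightarrow> d + 0"
    by (intro tendsto_intros LIMSEQ_inverse_real_of_nat)
  then have "dist x s \<le> d"
    using s unfolding C_def by (intro LIMSEQ_le_const) auto
  moreover have "s \<in> S" using s unfolding C_def by blast
  ultimately show ?thesis using d_le by force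
qed

lemma orthogonal_projection_existence:
  fixes S :: "'a::{real_inner,complete_space} set"
  assumes "closed S" "subspace S"
  obtains s where "s \<in> S" "\<And>t. t \<in> S \<Longrightarrow> inner (x - s) t = 0"
proof -
  have "convex S" "S \<noteq> {}"
    using assms subspace_imp_convex subspace_0 by auto
  then obtain s where s: "s \<in> S" and closest: "\<forall>t\<in>S. dist x s \<le> dist x t"
    using closest_point_existence[OF assms(1), of x] by blast
  have le: "inner (x - s) t \<le> 0" if "t \<in> S" for t
    using any_closest_point_dot[OF \<open>convex S\<close> assms(1) s _ closest, of "s + t"]
      subspace_add[OF assms(2) s that] by simp
  have "inner (x - s) t = 0" if "t \<in> S" for t
    using le[OF that] le[OF subspace_neg[OF assms(2) that]] by simp
  then show thesis using that s by blast
qed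

lemma Riesz_representation:
  fixes f :: "'a::{real_inner,complete_space} \<Rightarrow> real"
  assumes "bounded_linear f"
  shows "\<exists>z. \<forall>v. f v = inner z v"
proof (cases "\<forall>v. f v = 0")
  case True
  then show ?thesis by (intro exI[of _ 0]) simp
next
  case False
  then obtain x where x: "f x \<noteq> 0" by blast
  interpret f: bounded_linear f by fact
  define S where "S = {v. f v = 0}"
  have "closed S" unfolding S_def
    by (intro closed_Collect_eq continuous_intros f.continuous_on)
  moreover have "subspace S"
    unfolding S_def subspace_def by (simp add: f.zero f.add f.scaleR)
  ultimately obtain s where s: "s \<in> S" and orth: "\<And>t. t \<in> S \<Longrightarrow> inner (x - s) t = 0"
    using orthogonal_projection_existence[of S x] by blast
  define w where "w = x - s"
  have fw: "f w = f x" unfolding w_def using s by (simp add: f.diff S_def)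
  then have "w \<noteq> 0" using x f.zero by auto
  have "f v = inner ((f w / inner w w) *\<^sub>R w) v" for v
  proof -
    have "v - (f v / f w) *\<^sub>R w \<in> S"
      unfolding S_def using x fw by (simp add: f.diff f.scaleR)
    from orth[OF this] have "inner w v = f v / f w * inner w w"
      unfolding w_def[symmetric] by (simp add: inner_diff_right)
    then show ?thesis using \<open>w \<noteq> 0\<close> x fw by simp
  qed
  then show ?thesis by blast
qed

text \<open>
  The Riesz representation applied to \<open>\<beta> u\<close> for every \<open>u\<close>; the norm estimate comes from testing
  with \<open>v = B u\<close>.
\<close>

lemma bounded_bilinear_form_operator:
  fixes \<beta> :: "'a::{real_inner,complete_space} \<Rightarrow> 'a \<Rightarrow> real"
  assumes "bounded_bilinear \<beta>"
  obtains B where "bounded_linear B" "\<And>u v. \<beta> u v = inner (B u) v"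
proof -
  interpret \<beta>: bounded_bilinear \<beta> by fact
  obtain B where B: "\<And>u v. \<beta> u v = inner (B u) v"
    using Riesz_representation[OF \<beta>.bounded_linear_right] by metis
  have eqI: "x = y" if "\<And>v. inner x v = inner y v" for x y :: 'a
    using that by (metis inner_diff_left inner_eq_zero_iff right_minus_eq)
  obtain K where "K > 0" and K: "\<And>u v. norm (\<beta> u v) \<le> norm u * norm v * K"
    using \<beta>.pos_bounded by blast
  have "bounded_linear B"
  proof (rule bounded_linear_intro)
    show "B (x + y) = B x + B y" for x y
      by (rule eqI) (simp add: B[symmetric] inner_add_left \<beta>.add_left)
    show "B (r *\<^sub>R x) = r *\<^sub>R B x" for r x
      by (rule eqI) (simp add: B[symmetric] \<beta>.scaleR_left)
    show "norm (B x) \<le> norm x * K" for x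
    proof (cases "B x = 0")
      case False
      have "(norm (B x))\<^sup>2 = \<beta> x (B x)"
        by (simp add: B power2_norm_eq_inner)
      also have "\<dots> \<le> norm x * K * norm (B x)"
        using K[of x "B x"] by (simp add: mult_ac)
      finally show ?thesis
        using False by (simp add: power2_eq_square)
    qed (use \<open>K > 0\<close> in simp)
  qed
  with B show thesis using that by blast
qed

section \<open>Absorbing a compact term\<close>

lemma orthogonal_complement_closed_subspace:
  fixes S :: "'a::real_inner set"
  shows "closed {u. \<forall>t\<in>S. inner u t = 0}" "subspace {u. \<forall>t\<in>S. inner u t = 0}"
proof -
  have "{u. \<forall>t\<in>S. inner u t = 0} = (\<Inter>t\<in>S. {u. inner u t = 0})" by auto
  also have "closed \<dots>"
    by (intro closed_INT ballI closed_Collect_eq continuous_intros)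
  finally show "closed {u. \<forall>t\<in>S. inner u t = 0}" .
  show "subspace {u. \<forall>t\<in>S. inner u t = 0}"
    by (simp add: subspace_def inner_add_left)
qed

text \<open>
  If the inequality fails for all \<open>C\<close>, unit vectors \<open>v\<close> exist with \<open>J v\<close> arbitrarily small and
  \<open>T v\<close> bounded away from \<open>0\<close>. By compactness \<open>T v\<close> converges along a subsequence to some \<open>z \<noteq> 0\<close>.
  The conditions of being within \<open>1/(n+1)\<close> of \<open>J v = 0\<close> and of \<open>T v = z\<close> define nested closed
  convex sets in the unit ball of \<open>X\<close>, and a common point \<open>x\<close> has \<open>J x = 0\<close> but \<open>T x = z \<noteq> 0\<close>.
\<close>

lemma Ehrling_inequality:
  fixes T :: "'a::{real_inner,complete_space} \<Rightarrow> 'b::real_normed_vector"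
    and J :: "'a \<Rightarrow> 'c::real_normed_vector"
  assumes closed: "closed X" and subspace: "subspace X"
    and T: "bounded_linear T" and compact: "compact (closure (T ` cball 0 1))"
    and J: "bounded_linear J"
    and ker: "\<And>u. u \<in> X \<Longrightarrow> J u = 0 \<Longrightarrow> T u = 0"
    and "0 < \<epsilon>"
  shows "\<exists>C\<ge>0. \<forall>u\<in>X. (norm (T u))\<^sup>2 \<le> \<epsilon> * (norm u)\<^sup>2 + C * (norm (J u))\<^sup>2"
proof (rule ccontr)
  assume neg: "\<not> ?thesis"
  interpret T: bounded_linear T by fact
  interpret J: bounded_linear J by fact
  have "\<exists>v\<in>X. norm v = 1 \<and> \<epsilon> + real (Suc n) * (norm (J v))\<^sup>2 < (norm (T v))\<^sup>2" for n
  proof -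
    obtain u where u: "u \<in> X"
      and gt: "\<epsilon> * (norm u)\<^sup>2 + real (Suc n) * (norm (J u))\<^sup>2 < (norm (T u))\<^sup>2"
      using neg by (metis not_le of_nat_0_le_iff)
    have "u \<noteq> 0"
      using gt T.zero J.zero by auto
    define v where "v = (1 / norm u) *\<^sub>R u"
    have "(norm (J v))\<^sup>2 = (norm (J u))\<^sup>2 / (norm u)\<^sup>2" "(norm (T v))\<^sup>2 = (norm (T u))\<^sup>2 / (norm u)\<^sup>2"
      unfolding v_def by (simp_all add: J.scaleR T.scaleR power_divide)
    moreover have "(\<epsilon> * (norm u)\<^sup>2 + real (Suc n) * (norm (J u))\<^sup>2) / (norm u)\<^sup>2 < (norm (T u))\<^sup>2 / (norm u)\<^sup>2"
      using gt \<open>u \<noteq> 0\<close> by (intro divide_strict_right_mono) auto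
    ultimately have "\<epsilon> + real (Suc n) * (norm (J v))\<^sup>2 < (norm (T v))\<^sup>2"
      using \<open>u \<noteq> 0\<close> by (simp add: add_divide_distrib)
    moreover have "v \<in> X" "norm v = 1"
      unfolding v_def using u subspace \<open>u \<noteq> 0\<close> by (auto simp: subspace_scale)
    ultimately show ?thesis by blast
  qed
  then obtain v where vX: "\<And>n. v n \<in> X" and norm_v: "\<And>n. norm (v n) = 1"
    and v: "\<And>n. \<epsilon> + real (Suc n) * (norm (J (v n)))\<^sup>2 < (norm (T (v n)))\<^sup>2"
    by metis
  obtain K where K: "\<And>u. norm (T u) \<le> norm u * K"
    using T.bounded by blast
  have Jv_le: "(norm (J (v n)))\<^sup>2 \<le> K\<^sup>2 * inverse (real (Suc n))" for n
  proof -
    have "(norm (T (v n)))\<^sup>2 \<le> K\<^sup>2"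
      using K[of "v n"] norm_v by (intro power_mono) auto
    then have "real (Suc n) * (norm (J (v n)))\<^sup>2 \<le> K\<^sup>2"
      using v[of n] \<open>0 < \<epsilon>\<close> by linarith
    then show ?thesis
      by (simp add: field_simps del: of_nat_Suc)
  qed
  have "(\<lambda>n. K\<^sup>2 * inverse (real (Suc n))) \<longlonglongrightarrow> 0"
    by (rule tendsto_mult_right_zero[OF LIMSEQ_inverse_real_of_nat])
  then have "(\<lambda>n. (norm (J (v n)))\<^sup>2) \<longlonglongrightarrow> 0"
    by (rule tendsto_sandwich[of "\<lambda>_. 0", rotated 3]) (use Jv_le in auto)
  then have "(\<lambda>n. sqrt ((norm (J (v n)))\<^sup>2)) \<longlonglongrightarrow> sqrt 0"
    by (rule tendsto_real_sqrt)
  then have Jv: "(\<lambda>n. norm (J (v n))) \<longlonglongrightarrow> 0" by simp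
  have "\<forall>n. T (v n) \<in> closure (T ` cball 0 1)"
    using norm_v by (intro allI closure_subset[THEN subsetD] imageI) simp
  then obtain z r where r: "strict_mono r" and "((\<lambda>n. T (v n)) \<circ> r) \<longlonglongrightarrow> z"
    using compact[unfolded compact_def, THEN spec, of "\<lambda>n. T (v n)"] by blast
  then have Tz: "(\<lambda>n. T (v (r n))) \<longlonglongrightarrow> z" by (simp add: o_def)
  have Jr: "(\<lambda>n. norm (J (v (r n)))) \<longlonglongrightarrow> 0"
    using LIMSEQ_subseq_LIMSEQ[OF Jv r] by (simp add: o_def)
  have "\<epsilon> \<le> (norm (T (v n)))\<^sup>2" for n
    using v[of n] by (smt (verit) mult_nonneg_nonneg of_nat_0_le_iff zero_le_power2)
  then have "\<epsilon> \<le> (norm z)\<^sup>2"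
    using tendsto_power[OF tendsto_norm[OF Tz], of 2] by (intro LIMSEQ_le_const) auto
  with \<open>0 < \<epsilon>\<close> have "z \<noteq> 0" by auto
  define C where "C n = X \<inter> cball 0 1 \<inter> J -` cball 0 (inverse (real (Suc n)))
      \<inter> T -` cball z (inverse (real (Suc n)))" for n
  have "\<exists>x. \<forall>n. x \<in> C n"
  proof (rule nested_closed_convex_nonempty)
    fix n
    show "closed (C n)"
      unfolding C_def
      by (intro closed_Int closed continuous_closed_vimage closed_cball
          J.isCont[OF continuous_ident] T.isCont[OF continuous_ident])
    show "convex (C n)"
      unfolding C_def using subspace
      by (intro convex_Int convex_linear_vimage convex_cball subspace_imp_convex J.linear T.linear)
    have "\<forall>\<^sub>F k in sequentially. norm (J (v (r k))) < inverse (real (Suc n))"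
      by (intro order_tendstoD[OF Jr]) simp
    moreover have "\<forall>\<^sub>F k in sequentially. dist (T (v (r k))) z < inverse (real (Suc n))"
      by (intro tendstoD[OF Tz]) simp
    ultimately have "\<forall>\<^sub>F k in sequentially. v (r k) \<in> C n"
      by eventually_elim (use vX norm_v in \<open>auto simp: C_def dist_commute\<close>)
    then show "C n \<noteq> {}"
      by (auto dest: eventually_happens')
  next
    show "decseq C"
    proof (rule decseq_SucI)
      fix n
      have "inverse (real (Suc (Suc n))) \<le> inverse (real (Suc n))"
        by (intro le_imp_inverse_le) auto
      then show "C (Suc n) \<subseteq> C n"
        unfolding C_def by (intro Int_mono vimage_mono order_refl subset_cball)
    qed
    show "bounded (C 0)"
      by (rule bounded_subset[OF bounded_cball[of 0 1]]) (auto simp: C_def)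
  qed
  then obtain x where x: "\<And>n. x \<in> C n" by blast
  have "norm (J x) \<le> 0"
    by (rule LIMSEQ_le_const[OF LIMSEQ_inverse_real_of_nat]) (use x in \<open>auto simp: C_def\<close>)
  moreover have "dist z (T x) \<le> 0"
    by (rule LIMSEQ_le_const[OF LIMSEQ_inverse_real_of_nat]) (use x in \<open>auto simp: C_def\<close>)
  ultimately show False
    using ker[of x] x[of 0] \<open>z \<noteq> 0\<close> by (auto simp: C_def)
qed

section \<open>Solvability of compactly elliptic equations\<close>

text \<open>
  One half of the Fredholm alternative. On \<open>X = (ker B)\<^sup>\<bottom>\<close> the operator \<open>B\<close> of the form is injective,
  so \<open>T\<close> can be estimated by \<open>B\<close>, which makes \<open>B\<close> bounded below on \<open>X\<close> and its range closed. The part of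
  \<open>g\<close> orthogonal to the range is annihilated by \<open>\<beta>\<close> from the left, and therefore vanishes by the
  hypothesis on \<open>g\<close>.
\<close>

lemma compactly_elliptic_solvable:
  fixes \<beta> :: "'a::{real_inner,complete_space} \<Rightarrow> 'a \<Rightarrow> real"
    and T :: "'a \<Rightarrow> 'b::real_normed_vector"
  assumes \<beta>: "bounded_bilinear \<beta>"
    and T: "bounded_linear T" "compact (closure (T ` cball 0 1))"
    and "0 < \<mu>" and elliptic: "\<And>u. \<mu> * (norm u)\<^sup>2 \<le> \<beta> u u + \<omega> * (norm (T u))\<^sup>2"
    and g: "bounded_linear g" and g_ker: "\<And>v. (\<And>u. \<beta> u v = 0) \<Longrightarrow> g v = 0"
  shows "\<exists>u. \<forall>v. \<beta> u v = g v"
proof -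
  obtain B where "bounded_linear B" and B: "\<And>u v. \<beta> u v = inner (B u) v"
    using bounded_bilinear_form_operator[OF \<beta>] by blast
  interpret B: bounded_linear B by fact
  obtain y where y: "\<And>v. g v = inner y v"
    using Riesz_representation[OF g] by blast
  define S where "S = {u. B u = 0}"
  define X where "X = {u. \<forall>t\<in>S. inner u t = 0}"
  have S: "closed S" "subspace S"
    unfolding S_def
    by (auto intro!: closed_Collect_eq continuous_intros B.continuous_on
        simp: subspace_def B.zero B.add B.scaleR)
  have X: "closed X" "subspace X"
    unfolding X_def by (rule orthogonal_complement_closed_subspace)+
  define K where "K = \<bar>\<omega>\<bar>"
  \<comment> \<open>The factor makes \<open>K * e\<close> at most \<open>\<mu> / 2\<close>; adding 1 to \<open>K\<close> avoids division by zero.\<close>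
  define e where "e = \<mu> / (2 * (K + 1))"
  have "0 \<le> K" "0 < e" unfolding e_def K_def using \<open>0 < \<mu>\<close> by auto
  have Ke: "K * e \<le> \<mu> / 2"
    unfolding e_def using \<open>0 \<le> K\<close> \<open>0 < \<mu>\<close> by (simp add: field_simps)
  have "T u = 0" if "u \<in> X" "B u = 0" for u
  proof -
    have "inner u u = 0" using that unfolding X_def S_def by blast
    then show ?thesis using linear_0 T(1) bounded_linear.linear by auto
  qed
  then obtain C where "0 \<le> C"
    and C: "\<And>u. u \<in> X \<Longrightarrow> (norm (T u))\<^sup>2 \<le> e * (norm u)\<^sup>2 + C * (norm (B u))\<^sup>2"
    using Ehrling_inequality[OF X T B.bounded_linear_axioms _ \<open>0 < e\<close>] by metis
  \<comment> \<open>The constant that the estimate \<open>lower\<close> below produces after taking roots.\<close>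
  define c where "c = sqrt ((\<mu> / 4) / (1 / \<mu> + K * C))"
  have "0 < 1 / \<mu> + K * C"
    using \<open>0 < \<mu>\<close> \<open>0 \<le> K\<close> \<open>0 \<le> C\<close> by (simp add: add_pos_nonneg)
  then have "0 < c" unfolding c_def using \<open>0 < \<mu>\<close> by simp
  have lower: "c * norm u \<le> norm (B u)" if "u \<in> X" for u
  proof -
    have "\<mu> * (norm u)\<^sup>2 \<le> inner (B u) u + \<omega> * (norm (T u))\<^sup>2"
      using elliptic by (simp add: B)
    also have "inner (B u) u \<le> norm (B u) * norm u"
      by (rule norm_cauchy_schwarz)
    also have "\<dots> \<le> \<mu> / 4 * (norm u)\<^sup>2 + 1 / \<mu> * (norm (B u))\<^sup>2"
    proof -
      have "0 \<le> (\<mu> / 2 * norm u - norm (B u))\<^sup>2 / \<mu>"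
        using \<open>0 < \<mu>\<close> by simp
      also have "\<dots> = \<mu> / 4 * (norm u)\<^sup>2 + 1 / \<mu> * (norm (B u))\<^sup>2 - norm (B u) * norm u"
        using \<open>0 < \<mu>\<close> by (simp add: power2_eq_square field_simps)
      finally show ?thesis by simp
    qed
    also have "\<omega> * (norm (T u))\<^sup>2 \<le> K * (norm (T u))\<^sup>2"
      unfolding K_def by (intro mult_right_mono) auto
    also have "\<dots> \<le> K * (e * (norm u)\<^sup>2 + C * (norm (B u))\<^sup>2)"
      using C[OF that] \<open>0 \<le> K\<close> by (rule mult_left_mono)
    also have "\<dots> \<le> \<mu> / 2 * (norm u)\<^sup>2 + K * C * (norm (B u))\<^sup>2"
      using mult_right_mono[OF Ke, of "(norm u)\<^sup>2"] by (simp add: algebra_simps)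
    finally have "\<mu> / 4 * (norm u)\<^sup>2 \<le> (1 / \<mu> + K * C) * (norm (B u))\<^sup>2"
      by (simp add: algebra_simps)
    then have "\<mu> / 4 * (norm u)\<^sup>2 / (1 / \<mu> + K * C) \<le> (norm (B u))\<^sup>2"
      by (subst pos_divide_le_eq[OF \<open>0 < 1 / \<mu> + K * C\<close>]) (simp only: mult.commute)
    then have "(\<mu> / 4) / (1 / \<mu> + K * C) * (norm u)\<^sup>2 \<le> (norm (B u))\<^sup>2"
      by (simp only: times_divide_eq_left)
    then have "sqrt ((\<mu> / 4) / (1 / \<mu> + K * C) * (norm u)\<^sup>2) \<le> sqrt ((norm (B u))\<^sup>2)"
      by (rule real_sqrt_le_mono)
    then show ?thesis
      unfolding c_def by (simp only: real_sqrt_mult real_sqrt_abs abs_norm_cancel)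
  qed
  have "complete (B ` X)"
    using complete_isometric_image[OF \<open>0 < c\<close> X(2) B.bounded_linear_axioms] lower X(1)
    by (simp add: complete_eq_closed)
  then have "closed (B ` X)"
    by (rule complete_imp_closed)
  then obtain p where "p \<in> B ` X" and p: "\<And>t. t \<in> B ` X \<Longrightarrow> inner (y - p) t = 0"
    using orthogonal_projection_existence[OF _ linear_subspace_image[OF B.linear X(2)], of y]
    by metis
  then obtain u where "p = B u" by blast
  with p have orth: "inner (y - B u) (B x) = 0" if "x \<in> X" for x
    using that by blast
  define r where "r = y - B u"
  have "\<beta> w r = 0" for w
  proof -
    obtain s where "s \<in> S" "\<And>t. t \<in> S \<Longrightarrow> inner (w - s) t = 0"
      by (rule orthogonal_projection_existence[OF S, of w]) (rule that)
    then have "inner r (B (w - s)) = 0" "B s = 0"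
      using orth unfolding X_def S_def r_def by blast+
    then show ?thesis by (simp add: B B.diff inner_commute)
  qed
  then have "inner y r = 0" "inner (B u) r = 0"
    using g_ker by (auto simp: y B)
  then have "inner r r = 0"
    by (subst r_def) (simp add: inner_diff_left)
  then have "y = B u" by (simp add: r_def)
  then show ?thesis by (auto simp: B y)
qed

section \<open>Lower bound away from the kernel of \<open>j\<close>\<close>

text \<open>
  For elements of the subspace \<open>Y\<close> of vectors that are \<open>\<beta>\<close>-orthogonal to \<open>ker J\<close>, both \<open>\<beta> u u\<close> and
  \<open>J u\<close> are unchanged when an element of \<open>N = Y \<inter> ker J\<close> is subtracted from \<open>u\<close>. This reduces the claim
  to \<open>X = Y \<inter> N\<^sup>\<bottom>\<close>, where \<open>J\<close> is injective and controls \<open>T\<close>.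
\<close>

lemma elliptic_form_bounded_below:
  fixes \<beta> :: "'a::{real_inner,complete_space} \<Rightarrow> 'a \<Rightarrow> real"
    and T :: "'a \<Rightarrow> 'b::real_normed_vector" and J :: "'a \<Rightarrow> 'c::real_normed_vector"
  assumes \<beta>: "bounded_bilinear \<beta>" and sym: "\<And>u v. \<beta> u v = \<beta> v u"
    and T: "bounded_linear T" "compact (closure (T ` cball 0 1))"
    and "0 < \<mu>" and elliptic: "\<And>u. \<mu> * (norm u)\<^sup>2 \<le> \<beta> u u + \<omega> * (norm (T u))\<^sup>2"
    and J: "bounded_linear J"
  shows "\<exists>C. \<forall>u. (\<forall>v. J v = 0 \<longrightarrow> \<beta> u v = 0) \<longrightarrow> 0 \<le> \<beta> u u + C * (norm (J u))\<^sup>2"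
proof -
  interpret \<beta>: bounded_bilinear \<beta> by fact
  interpret J: bounded_linear J by fact
  define Y where "Y = {u. \<forall>v. J v = 0 \<longrightarrow> \<beta> u v = 0}"
  define N where "N = Y \<inter> {u. J u = 0}"
  define X where "X = Y \<inter> {u. \<forall>t\<in>N. inner u t = 0}"
  have "Y = (\<Inter>v\<in>{v. J v = 0}. {u. \<beta> u v = 0})"
    unfolding Y_def by auto
  also have "closed \<dots>"
    by (intro closed_INT ballI closed_Collect_eq continuous_intros
        bounded_linear.continuous_on[OF \<beta>.bounded_linear_left])
  finally have "closed Y" .
  have "subspace Y"
    by (simp add: subspace_def Y_def \<beta>.zero_left \<beta>.add_left \<beta>.scaleR_left)
  have "subspace {u. J u = 0}"
    by (simp add: subspace_def J.zero J.add J.scaleR)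
  have "closed {u. J u = 0}"
    by (intro closed_Collect_eq continuous_intros J.continuous_on)
  have N: "closed N" "subspace N"
    unfolding N_def
    by (intro closed_Int subspace_inter \<open>closed Y\<close> \<open>subspace Y\<close> \<open>subspace {u. J u = 0}\<close>
        \<open>closed {u. J u = 0}\<close>)+
  have X: "closed X" "subspace X"
    unfolding X_def
    by (intro closed_Int subspace_inter \<open>closed Y\<close> \<open>subspace Y\<close>
        orthogonal_complement_closed_subspace)+
  define K where "K = \<bar>\<omega>\<bar>"
  define e where "e = \<mu> / (K + 1)"
  have "0 \<le> K" "0 < e" unfolding e_def K_def using \<open>0 < \<mu>\<close> by auto
  have Ke: "K * e \<le> \<mu>"
    unfolding e_def using \<open>0 \<le> K\<close> \<open>0 < \<mu>\<close> by (simp add: field_simps)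
  have "T u = 0" if "u \<in> X" "J u = 0" for u
  proof -
    have "inner u u = 0" using that unfolding X_def N_def by blast
    then show ?thesis using linear_0 T(1) bounded_linear.linear by auto
  qed
  then obtain C where "0 \<le> C"
    and C: "\<And>u. u \<in> X \<Longrightarrow> (norm (T u))\<^sup>2 \<le> e * (norm u)\<^sup>2 + C * (norm (J u))\<^sup>2"
    using Ehrling_inequality[OF X T J _ \<open>0 < e\<close>] by metis
  have on_X: "0 \<le> \<beta> u u + K * C * (norm (J u))\<^sup>2" if "u \<in> X" for u
  proof -
    have "\<omega> * (norm (T u))\<^sup>2 \<le> K * (norm (T u))\<^sup>2"
      unfolding K_def by (intro mult_right_mono) auto
    also have "\<dots> \<le> K * (e * (norm u)\<^sup>2 + C * (norm (J u))\<^sup>2)"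
      using C[OF that] \<open>0 \<le> K\<close> by (rule mult_left_mono)
    also have "\<dots> \<le> \<mu> * (norm u)\<^sup>2 + K * C * (norm (J u))\<^sup>2"
      using mult_right_mono[OF Ke, of "(norm u)\<^sup>2"] by (simp add: algebra_simps)
    finally show ?thesis using elliptic[of u] by linarith
  qed
  have "0 \<le> \<beta> u u + K * C * (norm (J u))\<^sup>2" if "u \<in> Y" for u
  proof -
    obtain n where n: "n \<in> N" and orth: "\<And>t. t \<in> N \<Longrightarrow> inner (u - n) t = 0"
      by (rule orthogonal_projection_existence[OF N, of u]) (rule that)
    have "n \<in> Y" "J n = 0" using n unfolding N_def by auto
    then have "u - n \<in> X"
      unfolding X_def using orth that subspace_diff[OF \<open>subspace Y\<close>] by blast
    moreover have "J (u - n) = J u" by (simp add: J.diff \<open>J n = 0\<close>)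
    moreover have "\<beta> (u - n) (u - n) = \<beta> u u"
    proof -
      have "\<beta> u n = 0" "\<beta> n n = 0"
        using that \<open>n \<in> Y\<close> \<open>J n = 0\<close> unfolding Y_def by auto
      then show ?thesis
        using sym[of n u] by (simp add: \<beta>.diff_left \<beta>.diff_right)
    qed
    ultimately show ?thesis using on_X by metis
  qed
  then show ?thesis unfolding Y_def by blast
qed

section \<open>Sesquilinear forms over the reals\<close>

text \<open>
  As for linear maps, continuity at the origin gives a bound on a small ball, and homogeneity in both
  arguments extends it.
\<close>

lemma bounded_bilinear_if_continuous:
  fixes f :: "'a::real_normed_vector \<Rightarrow> 'b::real_normed_vector \<Rightarrow> 'c::real_normed_vector"
  assumes add_left: "\<And>u v w. f (u + v) w = f u w + f v w"
    and add_right: "\<And>u v w. f u (v + w) = f u v + f u w"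
    and scaleR_left: "\<And>r u w. f (r *\<^sub>R u) w = r *\<^sub>R f u w"
    and scaleR_right: "\<And>r u w. f u (r *\<^sub>R w) = r *\<^sub>R f u w"
    and cont: "isCont (\<lambda>(u, v). f u v) (0, 0)"
  shows "bounded_bilinear f"
proof -
  have zero: "f 0 v = 0" "f u 0 = 0" for u v
    using scaleR_left[of 0 0 v] scaleR_right[of u 0 0] by simp_all
  obtain d where "0 < d" and d: "\<And>p. norm p < d \<Longrightarrow> norm ((\<lambda>(u, v). f u v) p) < 1"
    using cont zero unfolding continuous_at_eps_delta
    by (metis dist_0_norm dist_commute zero_less_one case_prod_conv zero_prod_def)
  have "norm (f u v) \<le> norm u * norm v * (9 / d\<^sup>2)" for u v
  proof (cases "u = 0 \<or> v = 0")
    case False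
    \<comment> \<open>Vectors of norm \<open>d / 3\<close>, so that the pair has norm at most \<open>2 * d / 3 < d\<close>.\<close>
    define u' where "u' = (d / (3 * norm u)) *\<^sub>R u"
    define v' where "v' = (d / (3 * norm v)) *\<^sub>R v"
    have "norm u' = d / 3" "norm v' = d / 3"
      unfolding u'_def v'_def using False \<open>0 < d\<close> by auto
    then have "norm (u', v') < d"
      using norm_Pair_le[of u' v'] \<open>0 < d\<close> by linarith
    then have "norm (f u' v') < 1" using d by force
    moreover have "norm (f u' v') = d\<^sup>2 / (9 * norm u * norm v) * norm (f u v)"
      unfolding u'_def v'_def using \<open>0 < d\<close>
      by (simp add: scaleR_left scaleR_right power2_eq_square)
    ultimately show ?thesis
      using False \<open>0 < d\<close> by (simp add: field_simps)
  qed (auto simp: zero)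
  then show ?thesis
    by unfold_locales (blast intro: assms(1-4))+
qed

lemma bounded_bilinear_add:
  assumes "bounded_bilinear f" "bounded_bilinear g"
  shows "bounded_bilinear (\<lambda>u v. f u v + g u v)"
proof -
  interpret f: bounded_bilinear f by fact
  interpret g: bounded_bilinear g by fact
  obtain K L where K: "\<And>u v. norm (f u v) \<le> norm u * norm v * K"
    and L: "\<And>u v. norm (g u v) \<le> norm u * norm v * L"
    using f.bounded g.bounded by blast
  have "norm (f u v + g u v) \<le> norm u * norm v * (K + L)" for u v
    using norm_triangle_le[OF add_mono[OF K L]] by (simp add: distrib_left)
  then show ?thesis
    by unfold_locales
      (auto simp: f.add_left f.add_right g.add_left g.add_right f.scaleR_left f.scaleR_right
        g.scaleR_left g.scaleR_right scaleR_add_right)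
qed

lemma cinner_scaleC_right: "cinner x (c *\<^sub>C y) = cnj c * cinner x y"
  by (metis cinner_commute cinner_scaleC_left complex_cnj_mult)

lemma cinner_self: "cinner x x = complex_of_real ((norm x)\<^sup>2)"
proof (rule complex_eqI)
  show "Re (cinner x x) = Re (complex_of_real ((norm x)\<^sup>2))"
    by (simp add: power2_norm_eq_inner inner_eq_Re_cinner)
  show "Im (cinner x x) = Im (complex_of_real ((norm x)\<^sup>2))"
    using cinner_commute[of x x] by (metis Im_complex_of_real Reals_cnj_iff complex_is_Real_iff)
qed

lemma norm_scaleC_ii: "norm (\<i> *\<^sub>C x) = norm x"
  by (simp add: norm_eq_sqrt_inner inner_eq_Re_cinner cinner_scaleC_left cinner_scaleC_right)

lemma bounded_linear_scaleC_ii: "bounded_linear (\<lambda>x. \<i> *\<^sub>C x)"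
  by (rule bounded_linear_intro[of _ 1])
    (simp_all add: scaleC_add_right norm_scaleC_ii scaleR_scaleC scaleC_scaleC mult.commute)

lemma sesquilinear_form_Re_bounded_bilinear:
  assumes "sesquilinear_form a" "continuous_form a"
  shows "bounded_bilinear (\<lambda>u v. Re (a u v))"
proof (rule bounded_bilinear_if_continuous)
  have "isCont (\<lambda>(u, v). a u v) (0, 0)"
    using assms(2) unfolding continuous_form_def
    by (simp add: continuous_on_eq_continuous_at)
  then show "isCont (\<lambda>(u, v). Re (a u v)) (0, 0)"
    using isCont_Re by (simp add: case_prod_unfold)
qed (use assms(1) in \<open>simp_all add: sesquilinear_form_def scaleR_scaleC\<close>)

section \<open>The associated graph\<close>

lemma bounded_clinear_simps:
  assumes "bounded_clinear T"
  shows "T (x + y) = T x + T y" "T (c *\<^sub>C x) = c *\<^sub>C T x" "T 0 = 0" "bounded_linear T"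
  using assms linear_0[OF bounded_linear.linear] linear_add[OF bounded_linear.linear]
  unfolding bounded_clinear_def by auto

lemma compactly_ellipticE:
  fixes a :: "'v::complex_hilbert_space \<Rightarrow> 'v \<Rightarrow> complex"
  assumes "compactly_elliptic TYPE('k::complex_hilbert_space) a"
  obtains T :: "'v \<Rightarrow> 'k::complex_hilbert_space" and \<omega> \<mu>
  where "bounded_linear T" "compact (closure (T ` cball 0 1))" "0 < \<mu>"
    "\<And>u. \<mu> * (norm u)\<^sup>2 \<le> Re (a u u) + \<omega> * (norm (T u))\<^sup>2"
proof -
  obtain T :: "'v \<Rightarrow> 'k" and \<omega> \<mu> where "compact_operator T" "0 < \<mu>"
    "\<And>u. \<mu> * (norm u)\<^sup>2 \<le> Re (a u u) + \<omega> * (norm (T u))\<^sup>2"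
    using assms unfolding compactly_elliptic_def by blast
  then show thesis
    using bounded_cball that unfolding compact_operator_def bounded_clinear_def by blast
qed

lemma linear_graph_associated_graph:
  assumes a: "sesquilinear_form a" and j: "bounded_clinear j"
  shows "linear_graph (associated_graph a j)"
  unfolding linear_graph_def
proof (intro conjI allI impI)
  note a = a[unfolded sesquilinear_form_def]
  note j = bounded_clinear_simps[OF j]
  have a0: "a 0 v = 0" for v
    using a by (metis add_cancel_right_left)
  have c0: "cinner 0 y = 0" for y :: 'b
    using cinner_add_left[of 0 0 y] by simp
  show "(0, 0) \<in> associated_graph a j"
    unfolding associated_graph_def using a0 c0 j(3) by auto
  fix x y
  assume "(x, y) \<in> associated_graph a j"
  then obtain u where u: "j u = x" "\<And>v. a u v = cinner y (j v)"
    unfolding associated_graph_def by blast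
  show "(c *\<^sub>C x, c *\<^sub>C y) \<in> associated_graph a j" for c
    unfolding associated_graph_def
    using u a j by (auto simp: cinner_scaleC_left intro!: exI[of _ "c *\<^sub>C u"])
  fix x' y'
  assume "(x', y') \<in> associated_graph a j"
  then obtain u' where "j u' = x'" "\<And>v. a u' v = cinner y' (j v)"
    unfolding associated_graph_def by blast
  then show "(x + x', y + y') \<in> associated_graph a j"
    unfolding associated_graph_def
    using u a j by (auto simp: cinner_add_left intro!: exI[of _ "u + u'"])
qed

lemma associated_graph_cinner:
  assumes "symmetric_form a" "(x, y) \<in> associated_graph a j"
  obtains u where "j u = x" "\<And>v. a u v = cinner y (j v)" "cinner x y = a u u" "a u u \<in> \<real>"
proof -
  obtain u where u: "j u = x" "\<And>v. a u v = cinner y (j v)"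
    using assms(2) unfolding associated_graph_def by blast
  have "a u u = cnj (a u u)"
    using assms(1) unfolding symmetric_form_def by blast
  then have "a u u \<in> \<real>" "cinner x y = a u u"
    using u cinner_commute[of x y] by (simp_all add: Reals_cnj_iff)
  with u that show thesis by blast
qed

text \<open>
  The solvability lemma is applied to the real part of \<open>b(u, v) = a(u, v) + i s (j u, j v)\<close>. On the
  diagonal the extra term is purely imaginary: it leaves ellipticity untouched, while it forces
  \<open>j v = 0\<close> for every \<open>v\<close> with \<open>b(\<cdot>, v) = 0\<close>.
\<close>

lemma graph_shift_surjective:
  fixes a :: "'v::complex_hilbert_space \<Rightarrow> 'v \<Rightarrow> complex"
    and j :: "'v \<Rightarrow> 'h::complex_hilbert_space"
  assumes a: "sesquilinear_form a" and cont: "continuous_form a" and sym: "symmetric_form a"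
    and elliptic: "compactly_elliptic TYPE('k::complex_hilbert_space) a"
    and j: "bounded_clinear j" and "s \<noteq> 0"
  shows "snd ` graph_shift (associated_graph a j) (\<i> * complex_of_real s) = UNIV"
proof -
  note aD = a[unfolded sesquilinear_form_def]
  note jD = bounded_clinear_simps[OF j]
  obtain T :: "'v \<Rightarrow> 'k" and \<omega> \<mu>
    where T: "bounded_linear T" "compact (closure (T ` cball 0 1))" and "\<mu> > 0"
      and ell: "\<And>u. \<mu> * (norm u)\<^sup>2 \<le> Re (a u u) + \<omega> * (norm (T u))\<^sup>2"
    by (rule compactly_ellipticE[OF elliptic]) (rule that)
  define b where "b u v = a u v + \<i> * complex_of_real s * cinner (j u) (j v)" for u v
  define \<beta> where "\<beta> u v = Re (b u v)" for u v
  have b_left: "b (\<i> *\<^sub>C u) v = \<i> * b u v" and b_right: "b u (\<i> *\<^sub>C v) = - \<i> * b u v" for u v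
    unfolding b_def using aD jD
    by (simp_all add: cinner_scaleC_left cinner_scaleC_right algebra_simps)
  have "bounded_bilinear (\<lambda>u v. inner (\<i> *\<^sub>C j u) (s *\<^sub>R j v))"
    using bounded_bilinear.comp[OF bounded_bilinear_inner
        bounded_linear_compose[OF bounded_linear_scaleC_ii jD(4)]
        bounded_linear_compose[OF bounded_linear_scaleR_right[of s] jD(4)]] .
  from bounded_bilinear_add[OF sesquilinear_form_Re_bounded_bilinear[OF a cont] this]
  have \<beta>_bounded: "bounded_bilinear \<beta>"
    unfolding \<beta>_def b_def
    by (simp add: inner_eq_Re_cinner cinner_scaleC_left cinner_scaleC_right scaleR_scaleC)
  have real: "Im (a u u) = 0" for u
    using sym unfolding symmetric_form_def by (metis Reals_cnj_iff complex_is_Real_iff)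
  have \<beta>_self: "\<beta> u u = Re (a u u)" and Im_b: "Im (b u u) = s * (norm (j u))\<^sup>2" for u
    unfolding \<beta>_def b_def cinner_self by (simp_all add: real)
  have "y \<in> snd ` graph_shift (associated_graph a j) (\<i> * complex_of_real s)" for y
  proof -
    have "\<exists>u. \<forall>v. \<beta> u v = inner y (j v)"
    proof (rule compactly_elliptic_solvable[OF \<beta>_bounded T \<open>\<mu> > 0\<close>])
      show "\<mu> * (norm u)\<^sup>2 \<le> \<beta> u u + \<omega> * (norm (T u))\<^sup>2" for u
        using ell by (simp add: \<beta>_self)
      show "bounded_linear (\<lambda>v. inner y (j v))"
        by (rule bounded_linear_compose[OF bounded_linear_inner_right jD(4)])
      fix v
      assume v: "\<And>u. \<beta> u v = 0"
      \<comment> \<open>\<open>\<beta>\<close> sees only real parts; multiplying the first argument by \<open>\<i>\<close> exposes the imaginary one.\<close>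
      have "Im (b v v) = 0"
        using v[of "\<i> *\<^sub>C v"] unfolding \<beta>_def b_left by simp
      then have "j v = 0" using Im_b \<open>s \<noteq> 0\<close> by simp
      then show "inner y (j v) = 0" by simp
    qed
    then obtain u where u: "\<And>v. \<beta> u v = inner y (j v)" by blast
    have "b u v = cinner y (j v)" for v
    proof (rule complex_eqI)
      show "Re (b u v) = Re (cinner y (j v))"
        using u by (simp add: \<beta>_def inner_eq_Re_cinner)
      \<comment> \<open>Antilinearity: \<open>Re (b u (\<i> v)) = Im (b u v)\<close>, and likewise for \<open>cinner\<close>.\<close>
      show "Im (b u v) = Im (cinner y (j v))"
        using u[of "\<i> *\<^sub>C v"] unfolding \<beta>_def b_right inner_eq_Re_cinner jD
        by (simp add: cinner_scaleC_right)
    qed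
    then have "a u v = cinner (y + (- (\<i> * complex_of_real s)) *\<^sub>C j u) (j v)" for v
      unfolding b_def cinner_add_left cinner_scaleC_left by (simp add: eq_diff_eq)
    then have "(j u, y + (- (\<i> * complex_of_real s)) *\<^sub>C j u) \<in> associated_graph a j"
      unfolding associated_graph_def by blast
    moreover have "y + (- (\<i> * complex_of_real s)) *\<^sub>C j u + (\<i> * complex_of_real s) *\<^sub>C j u = y"
      using scaleC_add_left[of "- (\<i> * complex_of_real s)" "\<i> * complex_of_real s" "j u"]
        scaleR_scaleC[of 0 "j u"] by (simp add: add.assoc)
    ultimately show ?thesis
      unfolding graph_shift_def by (force intro!: image_eqI[of _ snd "(j u, y)"])
  qed
  then show ?thesis by blast
qed

theorem theorem4p13:
  fixes a :: "'v::complex_hilbert_space \<Rightarrow> 'v \<Rightarrow> complex"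
    and j :: "'v \<Rightarrow> 'h::complex_hilbert_space"
  assumes "sesquilinear_form a"
    and "continuous_form a"
    and "symmetric_form a"
    and "compactly_elliptic TYPE('k::complex_hilbert_space) a"
    and "bounded_clinear j"
  shows "bounded_below_graph (associated_graph a j)"
proof -
  obtain T :: "'v \<Rightarrow> 'k" and \<omega> \<mu>
    where T: "bounded_linear T" "compact (closure (T ` cball 0 1))" and "\<mu> > 0"
      and ell: "\<And>u. \<mu> * (norm u)\<^sup>2 \<le> Re (a u u) + \<omega> * (norm (T u))\<^sup>2"
    by (rule compactly_ellipticE[OF assms(4)]) (rule that)
  have Re_sym: "Re (a u v) = Re (a v u)" for u v
    using assms(3) unfolding symmetric_form_def by (metis cnj.simps(1))
  have real: "cinner x y \<in> \<real>" if "(x, y) \<in> associated_graph a j" for x y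
    using associated_graph_cinner[OF assms(3) that] by metis
  have "selfadjoint_graph (associated_graph a j)"
    unfolding selfadjoint_graph_def
    using linear_graph_associated_graph[OF assms(1,5)] real graph_shift_surjective[OF assms]
    by blast
  moreover obtain C where C: "\<And>u. (\<And>v. j v = 0 \<Longrightarrow> Re (a u v) = 0) \<Longrightarrow>
      0 \<le> Re (a u u) + C * (norm (j u))\<^sup>2"
    using elliptic_form_bounded_below[OF
        sesquilinear_form_Re_bounded_bilinear[OF assms(1,2)] Re_sym T \<open>\<mu> > 0\<close> ell
        bounded_clinear_simps(4)[OF assms(5)]]
    by blast
  have "0 \<le> Re (cinner x y) + C * (norm x)\<^sup>2" if xy: "(x, y) \<in> associated_graph a j" for x y
  proof -
    obtain u where u: "j u = x" "\<And>v. a u v = cinner y (j v)" "cinner x y = a u u"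
      using associated_graph_cinner[OF assms(3) xy] by metis
    have "Re (a u v) = 0" if "j v = 0" for v
      using inner_zero_right[of y] by (simp add: u(2) that inner_eq_Re_cinner)
    then show ?thesis using C[of u] u by simp
  qed
  ultimately show ?thesis
    unfolding bounded_below_graph_def using real by blast
qed

end
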